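(* There exists a positive constant $C$, independent of the meshsize $h$ and of $\tau$, such that whenever $\tau\ge C h^2$ the spectral radius of $\mathcal{B}^{-1}\mathcal{A}$ satisfies $$\rho(\mathcal{B}^{-1}\mathcal{A})<2 ,$$ where $$\mathcal{A}=\begin{pmatrix}\tau A & M\\ M & -\tau B\end{pmatrix},\qquad \mathcal{B}=\begin{pmatrix}\tau A & \bar M\\ \bar M & -\tau B\end{pmatrix}.$$
   Context: Let $\Omega\subset\mathbb{R}^d$, $d\ge 1$, be a bounded polyhedral domain. The diffusion coefficients $a(x),b(x)$ are measurable (scalar, or symmetric matrix valued) functions on $\Omega$ satisfying the continuity and coercivity conditions $\lambda_a(x)|\xi|^2\le \xi^Ta(x)\xi\le\Lambda_a(x)|\xi|^2$ and $\lambda_b(x)|\xi|^2\le \xi^Tb(x)\xi\le\Lambda_b(x)|\xi|^2$ for all $\xi\in\mathbb{R}^d$, where $\lambda_a,\lambda_b$ are bounded below by positive constants and $\Lambda_a,\Lambda_b$ are bounded above. Let $\mathcal{T}$ be a shape-regular triangulation of $\Omega$ with meshsize $h$ (the shape-regularity constant being fixed as $h$ varies), and let $\mathbb{V}_{\mathcal{T}}\subset H^1_0(\Omega)$ be the space of continuous piecewise linear finite element functions over $\mathcal{T}$ vanishing on $\partial\Omega$, with nodal basis $\phi_1,\dots,\phi_{N_h}$, $N_h=\dim\mathbb{V}_{\mathcal{T}}$. Define the $N_h\times N_h$ matrices $$M_{ij}=\int_\Omega\phi_i\phi_j,\quad A_{ij}=\int_\Omega a\nabla\phi_i\cdot\nabla\phi_j,\quad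 B_{ij}=\int_\Omega b\nabla\phi_i\cdot\nabla\phi_j .$$ The lumped mass matrix $\bar M$ is the diagonal matrix whose diagonal entries are the row sums of $M$. The parameter $\tau>0$ is the square root of the time-step size. "Independent of $h$ and $\tau$" means that the constant may depend only on $\Omega$, the diffusion coefficients and the shape regularity of the triangulations. *)

theory Defs
  imports
    "HOL-Analysis.Analysis"
    "Jordan_Normal_Form.Spectral_Radius"
    "Jordan_Normal_Form.Gauss_Jordan_Elimination"
begin

(* Taking an interior rules out cracks: \<Omega> = interior (closure \<Omega>). *)
definition polyhedral_domain :: "'a::euclidean_space set \<Rightarrow> bool" where
  "polyhedral_domain \<Omega> \<longleftrightarrow>
     open \<Omega> \<and> connected \<Omega> \<and> bounded \<Omega> \<and> \<Omega> \<noteq> {} \<and>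
     (\<exists>P. finite P \<and> (\<forall>p\<in>P. polytope p) \<and> \<Omega> = interior (\<Union>P))"

(* A scalar coefficient \<alpha> is the matrix-valued coefficient \<alpha> x times the identity. *)
definition diffusion_coefficient :: "(real^'d) set \<Rightarrow> (real^'d \<Rightarrow> real^'d^'d) \<Rightarrow> bool" where
  "diffusion_coefficient \<Omega> a \<longleftrightarrow>
     a \<in> borel_measurable (lebesgue_on \<Omega>) \<and>
     (\<forall>x\<in>\<Omega>. transpose (a x) = a x) \<and>
     (\<exists>lam Lam :: real^'d \<Rightarrow> real.
        (\<exists>c>0. \<forall>x\<in>\<Omega>. c \<le> lam x) \<and>
        (\<exists>c. \<forall>x\<in>\<Omega>. Lam x \<le> c) \<and>
        (\<forall>x\<in>\<Omega>. \<forall>\<xi>. lam x * (norm \<xi>)\<^sup>2 \<le> \<xi> \<bullet> (a x *v \<xi>) \<and>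
                      \<xi> \<bullet> (a x *v \<xi>) \<le> Lam x * (norm \<xi>)\<^sup>2))"

(* The library's triangulation already requires finiteness and that any two
   simplices meet in a common face (no hanging nodes). *)
definition triangulation_of :: "'a::euclidean_space set \<Rightarrow> 'a set set \<Rightarrow> bool" where
  "triangulation_of \<Omega> T \<longleftrightarrow>
     triangulation T \<and> (\<forall>K\<in>T. int DIM('a) simplex K) \<and> \<Union>T = closure \<Omega>"

definition meshsize :: "'a::euclidean_space set set \<Rightarrow> real" where
  "meshsize T = Max (diameter ` T)"

definition inradius :: "'a::euclidean_space set \<Rightarrow> real" where
  "inradius K = Sup {r. 0 \<le> r \<and> (\<exists>x. cball x r \<subseteq> K)}"

definition shape_regular :: "real \<Rightarrow> 'a::euclidean_space set set \<Rightarrow> bool" where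
  "shape_regular \<sigma> T \<longleftrightarrow> (\<forall>K\<in>T. diameter K \<le> \<sigma> * (2 * inradius K))"

(* Finite element functions live on the whole space, extended by zero outside \<Omega>. *)
definition fe_space :: "'a::euclidean_space set \<Rightarrow> 'a set set \<Rightarrow> ('a \<Rightarrow> real) set" where
  "fe_space \<Omega> T =
     {u. continuous_on (closure \<Omega>) u \<and>
         (\<forall>K\<in>T. \<exists>g c. \<forall>x\<in>K. u x = g \<bullet> x + c) \<and>
         (\<forall>x. x \<notin> \<Omega> \<longrightarrow> u x = 0)}"

definition interior_nodes :: "'a::euclidean_space set \<Rightarrow> 'a set set \<Rightarrow> 'a set" where
  "interior_nodes \<Omega> T = {z \<in> \<Omega>. \<exists>K\<in>T. z extreme_point_of K}"

definition nodal_basis ::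
  "'a::euclidean_space set \<Rightarrow> 'a set set \<Rightarrow> nat \<Rightarrow> (nat \<Rightarrow> 'a \<Rightarrow> real) \<Rightarrow> bool" where
  "nodal_basis \<Omega> T N \<phi> \<longleftrightarrow>
     (\<exists>z. bij_betw z {..<N} (interior_nodes \<Omega> T) \<and>
          (\<forall>i<N. \<phi> i \<in> fe_space \<Omega> T \<and> (\<forall>j<N. \<phi> i (z j) = (if i = j then 1 else 0))))"

(* Classical gradient. A finite element function has it in the interior of every element,
   hence almost everywhere, and there it agrees with the weak gradient; on the remaining
   null set the value is immaterial. *)
definition gradient :: "('a::real_inner \<Rightarrow> real) \<Rightarrow> 'a \<Rightarrow> 'a" where
  "gradient u x = (THE D. GDERIV u x :> D)"

definition mass_matrix ::
  "'a::euclidean_space set \<Rightarrow> nat \<Rightarrow> (nat \<Rightarrow> 'a \<Rightarrow> real) \<Rightarrow> real mat" where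
  "mass_matrix \<Omega> N \<phi> =
     Matrix.mat N N (\<lambda>(i, j). LINT x|lebesgue_on \<Omega>. \<phi> i x * \<phi> j x)"

definition lumped :: "real mat \<Rightarrow> real mat" where
  "lumped M = mat_diag (dim_row M) (\<lambda>i. \<Sum>j<dim_col M. M $$ (i, j))"

definition stiffness_matrix ::
  "(real^'d) set \<Rightarrow> (real^'d \<Rightarrow> real^'d^'d) \<Rightarrow> nat \<Rightarrow> (nat \<Rightarrow> real^'d \<Rightarrow> real) \<Rightarrow> real mat" where
  "stiffness_matrix \<Omega> a N \<phi> =
     Matrix.mat N N (\<lambda>(i, j). LINT x|lebesgue_on \<Omega>. (a x *v gradient (\<phi> i) x) \<bullet> gradient (\<phi> j) x)"

(* system_matrix \<tau> A L B is the block matrix with rows (\<tau> A, L) and (L, -\<tau> B). *)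
definition system_matrix :: "real \<Rightarrow> real mat \<Rightarrow> real mat \<Rightarrow> real mat \<Rightarrow> real mat" where
  "system_matrix \<tau> A L B = four_block_mat (\<tau> \<cdot>\<^sub>m A) L L (- (\<tau> \<cdot>\<^sub>m B))"

end

theory Submission
  imports Defs
begin

text \<open>
  Let \<open>D\<close> be the lumped mass matrix minus the mass matrix. An eigenvalue \<open>\<mu>\<close> of \<open>\<B>\<^sup>-\<^sup>1\<A>\<close> with
  eigenvector \<open>(x, y)\<close> satisfies \<open>\<nu>\<B>(x, y) = (Dy, Dx)\<close> for \<open>\<nu> = 1 - \<mu>\<close>. Testing the first row with
  \<open>x\<close> and the second with \<open>-y\<close> makes the off-diagonal terms purely imaginary, so that
  \<open>\<bar>\<nu>\<bar> \<tau> (x\<^sup>*Ax + y\<^sup>*By) \<le> 2 \<bar>Im x\<^sup>*Dy\<bar> \<le> x\<^sup>*Dx + y\<^sup>*Dy\<close>. Now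
  \<open>x\<^sup>TDx = 1/2 \<Sum> M\<^sub>i\<^sub>j (x\<^sub>i - x\<^sub>j)\<^sup>2\<close>, and pointwise a.e.
  \<open>\<Sum> \<phi>\<^sub>i \<phi>\<^sub>j (x\<^sub>i - x\<^sub>j)\<^sup>2 \<le> h\<^sup>2 \<bar>\<nabla>u\<bar>\<^sup>2\<close> for \<open>u = \<Sum> x\<^sub>i \<phi>\<^sub>i\<close>, because overlapping basis
  functions have their nodes in a common simplex. Hence \<open>D\<close> is at most \<open>h\<^sup>2 / (2\<alpha>)\<close> times the
  stiffness matrices, \<open>\<bar>\<nu>\<bar> < 1\<close> as soon as \<open>\<tau> > h\<^sup>2 / (2\<alpha>)\<close>, and \<open>\<bar>\<mu>\<bar> \<le> 1 + \<bar>\<nu>\<bar> < 2\<close>.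
\<close>

section \<open>Perturbed saddle-point matrices\<close>

text \<open>Coefficient vectors are functions on \<open>nat\<close> of which only the values below
  \<open>N\<close> enter, so the real and imaginary parts of a complex vector are plain lambda
  terms.\<close>

definition qform :: "nat \<Rightarrow> real mat \<Rightarrow> (nat \<Rightarrow> real) \<Rightarrow> real" where
  "qform N S x = (\<Sum>i<N. \<Sum>j<N. x i * S $$ (i, j) * x j)"

definition sform :: "nat \<Rightarrow> real mat \<Rightarrow> (nat \<Rightarrow> complex) \<Rightarrow> (nat \<Rightarrow> complex) \<Rightarrow> complex" where
  "sform N S x y = (\<Sum>i<N. \<Sum>j<N. cnj (x i) * complex_of_real (S $$ (i, j)) * y j)"

definition symmetric :: "nat \<Rightarrow> real mat \<Rightarrow> bool" where
  "symmetric N S \<longleftrightarrow> (\<forall>i<N. \<forall>j<N. S $$ (i, j) = S $$ (j, i))"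

lemma sform_swap:
  assumes "symmetric N S"
  shows "sform N S y x = cnj (sform N S x y)"
proof -
  have "sform N S y x = (\<Sum>j<N. \<Sum>i<N. cnj (y i) * complex_of_real (S $$ (i, j)) * x j)"
    unfolding sform_def by (rule sum.swap)
  also have "\<dots> = (\<Sum>i<N. \<Sum>j<N. cnj (cnj (x i) * complex_of_real (S $$ (i, j)) * y j))"
    using assms by (intro sum.cong refl) (simp add: symmetric_def mult_ac)
  finally show ?thesis
    by (simp add: sform_def)
qed

text \<open>Exchanging the arguments conjugates the form, so its diagonal values are real. This
  carries positivity and comparison of real quadratic forms over to complex eigenvectors.\<close>

lemma sform_self:
  assumes "symmetric N S"
  shows "sform N S x x = of_real (qform N S (\<lambda>i. Re (x i)) + qform N S (\<lambda>i. Im (x i)))"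
proof (rule complex_eqI)
  show "Im (sform N S x x) = Im (of_real (qform N S (\<lambda>i. Re (x i)) + qform N S (\<lambda>i. Im (x i))))"
    using arg_cong[OF sform_swap[OF assms, of x x], of Im] by simp
  show "Re (sform N S x x) = Re (of_real (qform N S (\<lambda>i. Re (x i)) + qform N S (\<lambda>i. Im (x i))))"
    unfolding sform_def qform_def of_real_add plus_complex.sel Re_complex_of_real Re_sum
      sum.distrib[symmetric]
    by (intro sum.cong refl) (simp add: algebra_simps)
qed

lemma sform_add_scaled_self:
  "sform N S (\<lambda>i. x i + c * y i) (\<lambda>i. x i + c * y i)
     = sform N S x x + c * sform N S x y + cnj c * sform N S y x + cnj c * c * sform N S y y"
  by (simp add: sform_def sum.distrib sum_distrib_left algebra_simps)

text \<open>Positivity of the form at \<open>x \<plusminus> i y\<close> replaces Cauchy--Schwarz.\<close>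
lemma Im_sform_le:
  assumes sym: "symmetric N S" and pos: "\<And>x. 0 \<le> qform N S x"
  shows "2 * \<bar>Im (sform N S x y)\<bar> \<le> Re (sform N S x x) + Re (sform N S y y)"
proof -
  have *: "0 \<le> Re (sform N S u u)" for u
    by (simp add: sform_self[OF sym] pos)
  from *[of "\<lambda>i. x i + \<i> * y i"] *[of "\<lambda>i. x i + (-\<i>) * y i"] show ?thesis
    unfolding sform_add_scaled_self sform_swap[OF sym, of y x] by simp
qed

text \<open>The testing argument for an arbitrary perturbation \<open>D\<close>. It serves twice:
  with \<open>D = 0\<close> and \<open>\<nu> = 1\<close> it excludes a kernel, and with the lumping
  error as \<open>D\<close> it bounds the eigenvalues. The energy stays on both sides because its
  strict positivity is known only for nonzero vectors.\<close>

lemma saddle_point_eigenvalue_bound: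
  fixes \<nu> :: complex and \<tau> c :: real
  assumes sym: "symmetric N A" "symmetric N B" "symmetric N L" "symmetric N D"
    and posD: "\<And>x. 0 \<le> qform N D x"
    and DA: "\<And>x. qform N D x \<le> c * qform N A x"
    and DB: "\<And>x. qform N D x \<le> c * qform N B x"
    and eq1: "\<And>i. i < N \<Longrightarrow> \<nu> * (of_real \<tau> * (\<Sum>j<N. of_real (A $$ (i, j)) * x j)
                 + (\<Sum>j<N. of_real (L $$ (i, j)) * y j)) = (\<Sum>j<N. of_real (D $$ (i, j)) * y j)"
    and eq2: "\<And>i. i < N \<Longrightarrow> \<nu> * ((\<Sum>j<N. of_real (L $$ (i, j)) * x j)
                 - of_real \<tau> * (\<Sum>j<N. of_real (B $$ (i, j)) * y j)) = (\<Sum>j<N. of_real (D $$ (i, j)) * x j)"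
  shows "norm \<nu> * (\<tau> * (Re (sform N A x x) + Re (sform N B y y)))
           \<le> c * (Re (sform N A x x) + Re (sform N B y y))"
proof -
  define E where "E = Re (sform N A x x) + Re (sform N B y y)"
  define z where "z = sform N L x y"
  define w where "w = sform N D x y"
  have sf: "sform N S u v = (\<Sum>i<N. cnj (u i) * (\<Sum>j<N. of_real (S $$ (i, j)) * v j))" for S u v
    by (simp add: sform_def sum_distrib_left mult.assoc)
  have cnj_z: "cnj z = sform N L y x" and cnj_w: "cnj w = sform N D y x"
    unfolding z_def w_def by (simp_all only: sform_swap[OF sym(3), of x y] sform_swap[OF sym(4), of x y] complex_cnj_cnj)
  have 1: "\<nu> * (of_real \<tau> * sform N A x x + z) = w"
  proof -
    have "\<nu> * (of_real \<tau> * sform N A x x + z) = (\<Sum>i<N. cnj (x i) * (\<nu> * (of_real \<tau> * (\<Sum>j<N. of_real (A $$ (i, j)) * x j)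
                 + (\<Sum>j<N. of_real (L $$ (i, j)) * y j))))"
      unfolding z_def sf sum_distrib_left[of _ _ "{..<N}"] sum.distrib[symmetric]
      by (simp add: sum_distrib_left sum.distrib algebra_simps)
    also have "\<dots> = w"
      unfolding w_def sf by (intro sum.cong refl) (simp add: eq1)
    finally show ?thesis .
  qed
  have 2: "\<nu> * (cnj z - of_real \<tau> * sform N B y y) = cnj w"
  proof -
    have "\<nu> * (cnj z - of_real \<tau> * sform N B y y) = (\<Sum>i<N. cnj (y i) * (\<nu> * ((\<Sum>j<N. of_real (L $$ (i, j)) * x j)
                 - of_real \<tau> * (\<Sum>j<N. of_real (B $$ (i, j)) * y j))))"
      unfolding cnj_z sf
      by (simp add: sum_distrib_left sum_subtractf algebra_simps)
    also have "\<dots> = cnj w"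
      unfolding cnj_w sf
      by (intro sum.cong refl) (simp add: eq2)
    finally show ?thesis .
  qed
  have AE: "sform N A x x = of_real (Re (sform N A x x))" "sform N B y y = of_real (Re (sform N B y y))"
    by (simp_all add: sform_self[OF sym(1)] sform_self[OF sym(2)])
  have "of_real (\<tau> * E) = of_real \<tau> * sform N A x x + of_real \<tau> * sform N B y y"
    unfolding E_def of_real_mult of_real_add AE[symmetric] by (rule distrib_left)
  then have "\<nu> * (of_real (\<tau> * E) + (z - cnj z))
      = \<nu> * (of_real \<tau> * sform N A x x + z) - \<nu> * (cnj z - of_real \<tau> * sform N B y y)"
    by (simp only: right_diff_distrib[symmetric]) (simp add: algebra_simps)
  then have "\<nu> * (of_real (\<tau> * E) + (z - cnj z)) = w - cnj w"
    unfolding 1 2 .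
  then have "norm \<nu> * norm (of_real (\<tau> * E) + (z - cnj z)) = 2 * \<bar>Im w\<bar>"
    by (simp flip: norm_mult) (simp add: complex_diff_cnj norm_mult)
  \<comment> \<open>The difference \<open>z - cnj z\<close> is purely imaginary, so
    \<open>\<tau> * E\<close> is the real part of the bracket.\<close>
  moreover have "\<tau> * E \<le> norm (of_real (\<tau> * E) + (z - cnj z))"
    using complex_Re_le_cmod[of "of_real (\<tau> * E) + (z - cnj z)"] by simp
  ultimately have "norm \<nu> * (\<tau> * E) \<le> 2 * \<bar>Im w\<bar>"
    by (metis mult_left_mono norm_ge_zero)
  also have "\<dots> \<le> Re (sform N D x x) + Re (sform N D y y)"
    unfolding w_def by (rule Im_sform_le[OF sym(4) posD])
  \<comment> \<open>The comparisons hold for real vectors and are applied to real and imaginary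
    parts separately.\<close>
  also have "\<dots> \<le> c * E"
    using DA[of "\<lambda>i. Re (x i)"] DA[of "\<lambda>i. Im (x i)"] DB[of "\<lambda>i. Re (y i)"] DB[of "\<lambda>i. Im (y i)"]
    by (simp add: E_def sform_self[OF sym(1)] sform_self[OF sym(2)] sform_self[OF sym(4)] algebra_simps)
  finally show ?thesis
    by (simp add: E_def)
qed

section \<open>Block systems and the spectral radius\<close>

lemma sum_lessThan_add: "(\<Sum>j<m + n. f j) = (\<Sum>j<m. f j) + (\<Sum>j<n::nat. f (m + j))"
  for f :: "nat \<Rightarrow> 'a::comm_monoid_add"
  by (induction n) (simp_all add: add.assoc)

text \<open>Stated for a general scalar type through \<open>of_real\<close>, because the kernel
  vector below is real while the eigenvector is complex.\<close>

lemma system_matrix_mult_vec: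
  fixes v :: "'a::{real_algebra_1, comm_ring_1} Matrix.vec"
  assumes car: "A \<in> carrier_mat N N" "L \<in> carrier_mat N N" "B \<in> carrier_mat N N"
    and v: "v \<in> carrier_vec (N + N)" and i: "i < N"
  shows "vec_index (map_mat of_real (system_matrix \<tau> A L B) *\<^sub>v v) i
           = of_real \<tau> * (\<Sum>j<N. of_real (A $$ (i, j)) * vec_index v j)
             + (\<Sum>j<N. of_real (L $$ (i, j)) * vec_index v (N + j))"
    and "vec_index (map_mat of_real (system_matrix \<tau> A L B) *\<^sub>v v) (N + i)
           = (\<Sum>j<N. of_real (L $$ (i, j)) * vec_index v j)
             - of_real \<tau> * (\<Sum>j<N. of_real (B $$ (i, j)) * vec_index v (N + j))"
proof -
  have dims: "dim_row A = N" "dim_col A = N" "dim_row L = N" "dim_col L = N" "dim_row B = N" "dim_col B = N"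
    "dim_vec v = N + N"
    using v car by auto
  show "vec_index (map_mat of_real (system_matrix \<tau> A L B) *\<^sub>v v) i
           = of_real \<tau> * (\<Sum>j<N. of_real (A $$ (i, j)) * vec_index v j)
             + (\<Sum>j<N. of_real (L $$ (i, j)) * vec_index v (N + j))"
    using i by (simp add: system_matrix_def scalar_prod_def dims atLeast0LessThan sum_lessThan_add
        sum_distrib_left mult.assoc)
  show "vec_index (map_mat of_real (system_matrix \<tau> A L B) *\<^sub>v v) (N + i)
           = (\<Sum>j<N. of_real (L $$ (i, j)) * vec_index v j)
             - of_real \<tau> * (\<Sum>j<N. of_real (B $$ (i, j)) * vec_index v (N + j))"
    using i by (simp add: system_matrix_def scalar_prod_def dims atLeast0LessThan sum_lessThan_add
        sum_distrib_left mult.assoc sum_negf)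
qed

lemma system_matrix_carrier:
  assumes "A \<in> carrier_mat N N" "B \<in> carrier_mat N N"
  shows "system_matrix \<tau> A L B \<in> carrier_mat (N + N) (N + N)"
  using assms by (auto simp: system_matrix_def)

lemma vec_eq_zero_halves:
  assumes v: "v \<in> carrier_vec (N + N)"
    and "\<And>i. i < N \<Longrightarrow> vec_index v i = 0" "\<And>i. i < N \<Longrightarrow> vec_index v (N + i) = 0"
  shows "v = 0\<^sub>v (N + N)"
proof (rule eq_vecI)
  fix i assume i: "i < dim_vec (0\<^sub>v (N + N))"
  show "vec_index v i = vec_index (0\<^sub>v (N + N)) i"
  proof (cases "i < N")
    case False
    then have "N + (i - N) = i" "i - N < N" using i by auto
    with assms(3)[of "i - N"] show ?thesis using i by simp
  qed (use assms i in auto)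
qed (use v in auto)

text \<open>The algebraic core: the finite element part only has to supply symmetry, definiteness
  and the comparison of \<open>L - M\<close> with both stiffness forms.\<close>

lemma spectral_radius_lumped_lt_2:
  fixes \<tau> c :: real
  assumes car: "A \<in> carrier_mat N N" "M \<in> carrier_mat N N" "L \<in> carrier_mat N N" "B \<in> carrier_mat N N"
    and N: "N > 0"
    and sym: "symmetric N A" "symmetric N B" "symmetric N L" "symmetric N (L - M)"
    and posA: "\<And>x. (\<exists>i<N. x i \<noteq> 0) \<Longrightarrow> 0 < qform N A x"
    and posB: "\<And>x. (\<exists>i<N. x i \<noteq> 0) \<Longrightarrow> 0 < qform N B x"
    and posD: "\<And>x. 0 \<le> qform N (L - M) x"
    and DA: "\<And>x. qform N (L - M) x \<le> c * qform N A x"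
    and DB: "\<And>x. qform N (L - M) x \<le> c * qform N B x"
    and c: "c < \<tau>" and \<tau>: "0 < \<tau>"
  shows "\<exists>Binv. mat_inverse (system_matrix \<tau> A L B) = Some Binv \<and>
           spectral_radius (map_mat complex_of_real (Binv * system_matrix \<tau> A M B)) < 2"
proof -
  let ?\<A> = "system_matrix \<tau> A M B" and ?\<B> = "system_matrix \<tau> A L B"
  let ?h = "map_mat complex_of_real"
  have carS: "?\<A> \<in> carrier_mat (N + N) (N + N)" "?\<B> \<in> carrier_mat (N + N) (N + N)"
    using car by (auto intro: system_matrix_carrier)
  have pos: "0 < Re (sform N S x x)"
    if S: "symmetric N S" "\<And>x. (\<exists>i<N. x i \<noteq> 0) \<Longrightarrow> 0 < qform N S x" and x: "\<exists>i<N. x i \<noteq> 0" for S x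
  proof -
    have nn: "0 \<le> qform N S u" for u
    proof (cases "\<exists>i<N. u i \<noteq> 0")
      case False
      then show ?thesis by (simp add: qform_def)
    qed (use S(2) in \<open>auto intro: less_imp_le\<close>)
    from x have "(\<exists>i<N. Re (x i) \<noteq> 0) \<or> (\<exists>i<N. Im (x i) \<noteq> 0)"
      by (auto simp: complex_eq_iff)
    then have "0 < qform N S (\<lambda>i. Re (x i)) \<or> 0 < qform N S (\<lambda>i. Im (x i))"
      using S(2)[of "\<lambda>i. Re (x i)"] S(2)[of "\<lambda>i. Im (x i)"] by blast
    then show ?thesis
      using nn[of "\<lambda>i. Re (x i)"] nn[of "\<lambda>i. Im (x i)"]
      by (auto simp: sform_self[OF S(1)] intro: add_pos_nonneg add_nonneg_pos)
  qed
  have sform_nonneg: "0 \<le> Re (sform N S x x)"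
    if S: "symmetric N S" "\<And>x. (\<exists>i<N. x i \<noteq> 0) \<Longrightarrow> 0 < qform N S x" for S x
  proof (cases "\<exists>i<N. x i \<noteq> 0")
    case False
    then show ?thesis by (simp add: sform_def)
  next
    case True
    then show ?thesis using pos[OF S, of x] by simp
  qed
  have E: "0 < Re (sform N A x x) + Re (sform N B y y)"
    if "(\<exists>i<N. x i \<noteq> 0) \<or> (\<exists>i<N. y i \<noteq> 0)" for x y
    using that
  proof
    assume "\<exists>i<N. x i \<noteq> 0"
    from pos[OF sym(1) posA this] sform_nonneg[OF sym(2) posB, of y] show ?thesis by simp
  next
    assume "\<exists>i<N. y i \<noteq> 0"
    from pos[OF sym(2) posB this] sform_nonneg[OF sym(1) posA, of x] show ?thesis by simp
  qed
  have nz: "(\<exists>i<N. vec_index v i \<noteq> 0) \<or> (\<exists>i<N. vec_index v (N + i) \<noteq> 0)"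
    if "v \<in> carrier_vec (N + N)" "v \<noteq> 0\<^sub>v (N + N)" for v :: "'b::zero Matrix.vec"
    using vec_eq_zero_halves[OF that(1)] that(2) by auto
  have "det ?\<B> \<noteq> 0"
  proof
    assume "det ?\<B> = 0"
    then obtain v where v: "v \<in> carrier_vec (N + N)" "v \<noteq> 0\<^sub>v (N + N)" "?\<B> *\<^sub>v v = 0\<^sub>v (N + N)"
      using det_0_iff_vec_prod_zero[OF carS(2)] by auto
    have id: "map_mat (of_real :: real \<Rightarrow> real) ?\<B> = ?\<B>"
      by (rule eq_matI) auto
    define x where "x i = complex_of_real (vec_index v i)" for i
    define y where "y i = complex_of_real (vec_index v (N + i))" for i
    have e1: "\<tau> * (\<Sum>j<N. A $$ (i, j) * vec_index v j) + (\<Sum>j<N. L $$ (i, j) * vec_index v (N + j)) = 0"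
      and e2: "(\<Sum>j<N. L $$ (i, j) * vec_index v j) - \<tau> * (\<Sum>j<N. B $$ (i, j) * vec_index v (N + j)) = 0"
      if "i < N" for i
      using system_matrix_mult_vec[OF car(1,3,4) v(1) that, of \<tau>] that unfolding id v(3) by auto
    \<comment> \<open>A kernel vector solves the perturbed equations with \<open>\<nu> = 1\<close>,
      zero perturbation and \<open>c = 0\<close>. The bound then makes \<open>\<tau>\<close> times a
      positive energy nonpositive.\<close>
    have "norm (1::complex) * (\<tau> * (Re (sform N A x x) + Re (sform N B y y)))
            \<le> 0 * (Re (sform N A x x) + Re (sform N B y y))"
    proof (rule saddle_point_eigenvalue_bound[where D = "0\<^sub>m N N" and L = L])
      fix i assume i: "i < N"
      have zero: "(\<Sum>j<N. complex_of_real ((0\<^sub>m N N) $$ (i, j)) * u j) = 0" for u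
        using i by (intro sum.neutral) auto
      from arg_cong[OF e1[OF i], of complex_of_real]
      show "1 * (complex_of_real \<tau> * (\<Sum>j<N. complex_of_real (A $$ (i, j)) * x j)
          + (\<Sum>j<N. complex_of_real (L $$ (i, j)) * y j)) = (\<Sum>j<N. complex_of_real ((0\<^sub>m N N) $$ (i, j)) * y j)"
        unfolding zero by (simp add: x_def y_def)
      from arg_cong[OF e2[OF i], of complex_of_real]
      show "1 * ((\<Sum>j<N. complex_of_real (L $$ (i, j)) * x j)
          - complex_of_real \<tau> * (\<Sum>j<N. complex_of_real (B $$ (i, j)) * y j)) = (\<Sum>j<N. complex_of_real ((0\<^sub>m N N) $$ (i, j)) * x j)"
        unfolding zero by (simp add: x_def y_def)
    qed (use sym in \<open>auto simp: symmetric_def qform_def\<close>)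
    moreover have "0 < Re (sform N A x x) + Re (sform N B y y)"
      using nz[OF v(1,2)] by (intro E) (auto simp: x_def y_def)
    ultimately show False
      using \<tau> by (simp add: mult_le_0_iff)
  qed
  then have "?\<B> \<in> Units (ring_mat TYPE(real) (N + N) ())"
    by (rule det_non_zero_imp_unit[OF carS(2)])
  then obtain Binv where Binv: "mat_inverse ?\<B> = Some Binv"
    using mat_inverse(1)[OF carS(2), of "()"] by (cases "mat_inverse ?\<B>") auto
  from mat_inverse(2)[OF carS(2) Binv]
  have inv: "?\<B> * Binv = 1\<^sub>m (N + N)" "Binv \<in> carrier_mat (N + N) (N + N)" by auto
  have carP: "?h (Binv * ?\<A>) \<in> carrier_mat (N + N) (N + N)"
    using inv carS by auto
  \<comment> \<open>Since \<open>N > 0\<close>, the spectrum is nonempty and the radius is attained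
    at an eigenvalue.\<close>
  have "spectral_radius (?h (Binv * ?\<A>)) \<in> norm ` spectrum (?h (Binv * ?\<A>))"
    using spectral_radius_mem_max(1)[OF carP] N by simp
  then obtain \<mu> v where \<rho>: "spectral_radius (?h (Binv * ?\<A>)) = norm \<mu>"
    and v: "v \<in> carrier_vec (N + N)" "v \<noteq> 0\<^sub>v (N + N)" "?h (Binv * ?\<A>) *\<^sub>v v = \<mu> \<cdot>\<^sub>v v"
    using inv by (auto simp: spectrum_def eigenvalue_def eigenvector_def)
  \<comment> \<open>Multiplying by the lumped system matrix removes the inverse and leaves a
    generalized eigenvalue problem.\<close>
  have "?h ?\<B> *\<^sub>v (?h (Binv * ?\<A>) *\<^sub>v v) = (?h ?\<B> * ?h (Binv * ?\<A>)) *\<^sub>v v"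
    using carS carP v by (intro assoc_mult_mat_vec[symmetric]) auto
  also have "?h ?\<B> * ?h (Binv * ?\<A>) = ?h (?\<B> * (Binv * ?\<A>))"
    using carS inv by (intro of_real_hom.mat_hom_mult[symmetric]) auto
  also have "?\<B> * (Binv * ?\<A>) = ?\<A>"
    using carS inv by (subst assoc_mult_mat[symmetric, of _ "N+N" "N+N" _ "N+N" _ "N+N"]) auto
  finally have eig: "?h ?\<A> *\<^sub>v v = \<mu> \<cdot>\<^sub>v (?h ?\<B> *\<^sub>v v)"
    using v carS by (simp add: mult_mat_vec)
  define \<nu> where "\<nu> = 1 - \<mu>"
  define x where "x i = vec_index v i" for i
  define y where "y i = vec_index v (N + i)" for i
  \<comment> \<open>Here \<open>r\<close> is the stiffness term, shared by both system matrices; it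
    cancels in the difference of the two rows and only lumped minus consistent mass remains.\<close>
  have rearrange1: "(1 - \<mu>) * (r + l) = l - m" if "r + m = \<mu> * (r + l)" for r l m :: complex
    unfolding left_diff_distrib that[symmetric] by simp
  have rearrange2: "(1 - \<mu>) * (l - r) = l - m" if "m - r = \<mu> * (l - r)" for r l m :: complex
    unfolding left_diff_distrib that[symmetric] by simp
  have dimB: "dim_row ?\<B> = N + N" using carS by auto
  have D: "(\<Sum>j<N. complex_of_real ((L - M) $$ (i, j)) * u j)
             = (\<Sum>j<N. of_real (L $$ (i, j)) * u j) - (\<Sum>j<N. of_real (M $$ (i, j)) * u j)" if "i < N" for i u
    using that car by (simp add: algebra_simps sum_subtractf)
  have "norm \<nu> * (\<tau> * (Re (sform N A x x) + Re (sform N B y y)))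
          \<le> c * (Re (sform N A x x) + Re (sform N B y y))"
  proof (rule saddle_point_eigenvalue_bound[OF sym posD DA DB])
    fix i assume i: "i < N"
    have "vec_index (?h ?\<A> *\<^sub>v v) i = \<mu> * vec_index (?h ?\<B> *\<^sub>v v) i"
      "vec_index (?h ?\<A> *\<^sub>v v) (N + i) = \<mu> * vec_index (?h ?\<B> *\<^sub>v v) (N + i)"
      unfolding eig using i by (auto simp: dimB)
    note e = this[unfolded system_matrix_mult_vec[OF car(1,3,4) v(1) i] system_matrix_mult_vec[OF car(1,2,4) v(1) i],
        folded x_def y_def]
    show "\<nu> * (complex_of_real \<tau> * (\<Sum>j<N. complex_of_real (A $$ (i, j)) * x j)
          + (\<Sum>j<N. complex_of_real (L $$ (i, j)) * y j)) = (\<Sum>j<N. complex_of_real ((L - M) $$ (i, j)) * y j)"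
      unfolding D[OF i] \<nu>_def by (rule rearrange1[OF e(1)])
    show "\<nu> * ((\<Sum>j<N. complex_of_real (L $$ (i, j)) * x j)
          - complex_of_real \<tau> * (\<Sum>j<N. complex_of_real (B $$ (i, j)) * y j)) = (\<Sum>j<N. complex_of_real ((L - M) $$ (i, j)) * x j)"
      unfolding D[OF i] \<nu>_def by (rule rearrange2[OF e(2)])
  qed
  moreover have Epos: "0 < Re (sform N A x x) + Re (sform N B y y)"
    using nz[OF v(1,2)] by (intro E) (auto simp: x_def y_def)
  ultimately have "norm \<nu> * \<tau> \<le> c"
    by (simp flip: mult.assoc)
  then have "norm \<nu> < 1"
    using c \<tau> mult_right_mono[of 1 "norm \<nu>" \<tau>] by linarith
  moreover have "norm \<mu> \<le> 1 + norm \<nu>"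
    using norm_triangle_ineq4[of 1 \<nu>] by (simp add: \<nu>_def)
  ultimately show ?thesis
    using Binv \<rho> by auto
qed

section \<open>Gradients, simplices and coefficients\<close>

no_notation Matrix.scalar_prod (infix \<open>\<bullet>\<close> 70)

text \<open>Half-spaces are convex. On a simplex this acts as a discrete maximum principle, reducing
  bounds for affine functions to their vertex values.\<close>

lemma affine_nonneg_on_hull:
  fixes g :: "'a::real_inner"
  assumes "\<And>v. v \<in> V \<Longrightarrow> 0 \<le> g \<bullet> v + c" and "x \<in> convex hull V"
  shows "0 \<le> g \<bullet> x + c"
proof -
  have "convex hull V \<subseteq> {x. g \<bullet> x \<ge> - c}"
    by (rule hull_minimal) (use assms(1) in \<open>fastforce simp: convex_halfspace_ge\<close>)+
  then show ?thesis
    using assms(2) by fastforce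
qed

text \<open>Uniqueness of the derivative makes the definite description in \<open>gradient\<close>
  usable.\<close>

lemma gradient_eqI:
  assumes "GDERIV u x :> D"
  shows "gradient u x = D"
  unfolding gradient_def
proof (rule the_equality)
  fix D' assume "GDERIV u x :> D'"
  then have "(\<lambda>h. h \<bullet> D') = (\<lambda>h. h \<bullet> D)"
    using assms unfolding gderiv_def by (rule has_derivative_unique)
  then have "h \<bullet> D' = h \<bullet> D" for h
    by (rule fun_cong)
  then show "D' = D"
    using vector_eq_ldot[of D' D] by blast
qed (rule assms)

lemma gradient_affine_on_open:
  assumes "open U" "x \<in> U" "\<And>y. y \<in> U \<Longrightarrow> u y = g \<bullet> y + c"
  shows "gradient u x = g"
proof (rule gradient_eqI)
  have "((\<lambda>y. g \<bullet> y + c) has_derivative (\<lambda>h. h \<bullet> g)) (at x)"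
    by (auto intro!: derivative_eq_intros simp: inner_commute)
  then show "GDERIV u x :> g"
    unfolding gderiv_def
    by (rule has_derivative_transform_within_open[OF _ assms(1,2)]) (simp add: assms(3))
qed

text \<open>The affine hull is the whole space, so the interior is the relative interior, which is
  nonempty for a nonempty convex set.\<close>

lemma simplex_interior_nonempty:
  fixes K :: "'a::euclidean_space set"
  assumes "int DIM('a) simplex K"
  shows "interior K \<noteq> {}"
proof -
  have "convex K" "K \<noteq> {}" "aff_dim K = DIM('a)"
    using assms aff_dim_simplex[OF assms]
    by (auto simp: convex_simplex simplex_def)
  then show ?thesis
    by (simp add: aff_dim_eq_full rel_interior_interior[symmetric] rel_interior_eq_empty)
qed

text \<open>Subtracting \<open>M\<close> from its row sums gives the Laplacian of a graph with edge
  weights \<open>M $$ (i, j)\<close>. Symmetrizing the double sum in \<open>i\<close> and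
  \<open>j\<close> completes the squares, whence the factor one half.\<close>

lemma qform_lumped_diff:
  assumes M: "M \<in> carrier_mat N N" "symmetric N M"
  shows "qform N (lumped M - M) x = (\<Sum>i<N. \<Sum>j<N. M $$ (i, j) * (x i - x j)\<^sup>2) / 2"
proof -
  have entry: "(lumped M - M) $$ (i, j) = (if i = j then (\<Sum>k<N. M $$ (i, k)) else 0) - M $$ (i, j)"
    if "i < N" "j < N" for i j
    using that M(1) by (auto simp: lumped_def mat_diag_def)
  have "qform N (lumped M - M) x
      = (\<Sum>i<N. \<Sum>j<N. (if i = j then x i * x j * (\<Sum>k<N. M $$ (i, k)) else 0) - x i * M $$ (i, j) * x j)"
    unfolding qform_def by (intro sum.cong refl) (auto simp: entry algebra_simps)
  also have "\<dots> = (\<Sum>i<N. \<Sum>j<N. M $$ (i, j) * (x i)\<^sup>2) - (\<Sum>i<N. \<Sum>j<N. x i * M $$ (i, j) * x j)"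
    unfolding sum_subtractf
    by (simp add: sum.delta' power2_eq_square sum_distrib_left mult_ac)
  also have "\<dots> = ((\<Sum>i<N. \<Sum>j<N. M $$ (i, j) * (x i)\<^sup>2) + (\<Sum>i<N. \<Sum>j<N. M $$ (i, j) * (x j)\<^sup>2)
      - 2 * (\<Sum>i<N. \<Sum>j<N. x i * M $$ (i, j) * x j)) / 2"
  proof -
    have "(\<Sum>i<N. \<Sum>j<N. M $$ (i, j) * (x j)\<^sup>2) = (\<Sum>j<N. \<Sum>i<N. M $$ (i, j) * (x j)\<^sup>2)"
      by (rule sum.swap)
    also have "\<dots> = (\<Sum>i<N. \<Sum>j<N. M $$ (i, j) * (x i)\<^sup>2)"
      using M(2) by (intro sum.cong refl) (simp add: symmetric_def)
    finally show ?thesis by simp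
  qed
  also have "\<dots> = (\<Sum>i<N. \<Sum>j<N. M $$ (i, j) * (x i - x j)\<^sup>2) / 2"
    unfolding sum_distrib_left sum.distrib[symmetric] sum_subtractf[symmetric]
    by (intro arg_cong[where f = "\<lambda>t. t / 2"] sum.cong refl) (simp add: power2_eq_square algebra_simps)
  finally show ?thesis .
qed

lemma symmetric_matrix_inner:
  fixes A :: "real^'d^'d"
  assumes "transpose A = A"
  shows "(A *v u) \<bullet> w = u \<bullet> (A *v w)"
  by (metis assms dot_lmul_matrix transpose_matrix_vector)

text \<open>Polarization writes the mixed term through the form at \<open>u + w\<close> and
  \<open>u - w\<close>; the parallelogram law then adds up the two upper bounds.\<close>

lemma coercive_inner_bound:
  fixes A :: "real^'d^'d"
  assumes sym: "transpose A = A"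
    and lo: "\<And>\<xi>. 0 \<le> \<xi> \<bullet> (A *v \<xi>)" and hi: "\<And>\<xi>. \<xi> \<bullet> (A *v \<xi>) \<le> \<beta> * (norm \<xi>)\<^sup>2"
  shows "\<bar>(A *v u) \<bullet> w\<bar> \<le> \<beta> * ((norm u)\<^sup>2 + (norm w)\<^sup>2) / 2"
proof -
  have pol: "4 * ((A *v u) \<bullet> w) = (u + w) \<bullet> (A *v (u + w)) - (u - w) \<bullet> (A *v (u - w))"
    using symmetric_matrix_inner[OF sym, of u w] symmetric_matrix_inner[OF sym, of w u]
    by (simp add: matrix_vector_right_distrib matrix_vector_mult_diff_distrib inner_add_left inner_add_right
        inner_diff_left inner_diff_right inner_commute)
  have par: "\<beta> * (norm (u + w))\<^sup>2 + \<beta> * (norm (u - w))\<^sup>2 = 2 * (\<beta> * ((norm u)\<^sup>2 + (norm w)\<^sup>2))"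
    by (simp add: power2_norm_eq_inner inner_add_left inner_add_right inner_diff_left inner_diff_right
        inner_commute algebra_simps)
  have "0 \<le> \<beta> * (norm (u + w))\<^sup>2" "0 \<le> \<beta> * (norm (u - w))\<^sup>2"
    using lo hi order_trans by blast+
  then show ?thesis
    using pol par lo[of "u + w"] lo[of "u - w"] hi[of "u + w"] hi[of "u - w"] by linarith
qed

text \<open>Passes from pointwise bounds to constants that depend on the coefficient alone, hence
  not on any mesh.\<close>

lemma diffusion_coefficient_bounds:
  fixes \<Omega> :: "(real^'d) set"
  assumes "diffusion_coefficient \<Omega> a"
  shows "\<exists>\<alpha> \<beta>. 0 < \<alpha> \<and> (\<forall>x\<in>\<Omega>. \<forall>\<xi>. \<alpha> * (norm \<xi>)\<^sup>2 \<le> \<xi> \<bullet> (a x *v \<xi>) \<and>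
    \<xi> \<bullet> (a x *v \<xi>) \<le> \<beta> * (norm \<xi>)\<^sup>2)"
proof -
  from assms obtain lam Lam \<alpha> \<beta> where *: "0 < \<alpha>" "\<forall>x\<in>\<Omega>. \<alpha> \<le> lam x" "\<forall>x\<in>\<Omega>. Lam x \<le> \<beta>"
    "\<forall>x\<in>\<Omega>. \<forall>\<xi>. lam x * (norm \<xi>)\<^sup>2 \<le> \<xi> \<bullet> (a x *v \<xi>) \<and> \<xi> \<bullet> (a x *v \<xi>) \<le> Lam x * (norm \<xi>)\<^sup>2"
    unfolding diffusion_coefficient_def by blast
  have "\<alpha> * (norm \<xi>)\<^sup>2 \<le> \<xi> \<bullet> (a x *v \<xi>) \<and> \<xi> \<bullet> (a x *v \<xi>) \<le> \<beta> * (norm \<xi>)\<^sup>2" if "x \<in> \<Omega>" for x \<xi>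
  proof -
    have "\<alpha> * (norm \<xi>)\<^sup>2 \<le> lam x * (norm \<xi>)\<^sup>2" "Lam x * (norm \<xi>)\<^sup>2 \<le> \<beta> * (norm \<xi>)\<^sup>2"
      using * that by (auto intro: mult_right_mono)
    then show ?thesis
      using *(4) that by (meson order_trans)
  qed
  with *(1) show ?thesis by blast
qed

section \<open>Piecewise linear finite elements\<close>

text \<open>Fixes one enumeration \<open>z\<close> of the interior nodes, which
  \<open>nodal_basis\<close> only asserts to exist.\<close>

locale fe_mesh =
  fixes \<Omega> :: "'a::euclidean_space set" and T :: "'a set set"
    and N :: nat and \<phi> :: "nat \<Rightarrow> 'a \<Rightarrow> real" and z :: "nat \<Rightarrow> 'a"
  assumes domain: "polyhedral_domain \<Omega>"
    and triangulation: "triangulation_of \<Omega> T"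
    and nodes: "bij_betw z {..<N} (interior_nodes \<Omega> T)"
    and fe: "i < N \<Longrightarrow> \<phi> i \<in> fe_space \<Omega> T"
    and delta: "i < N \<Longrightarrow> j < N \<Longrightarrow> \<phi> i (z j) = (if i = j then 1 else 0)"
begin

lemma open_\<Omega>: "open \<Omega>" and connected_\<Omega>: "connected \<Omega>" and bounded_\<Omega>: "bounded \<Omega>" and nonempty_\<Omega>: "\<Omega> \<noteq> {}"
  using domain by (auto simp: polyhedral_domain_def)

lemma finite_T: "finite T" and Union_T: "\<Union>T = closure \<Omega>"
  using triangulation by (auto simp: triangulation_of_def triangulation_def)

lemma simplex_K: "K \<in> T \<Longrightarrow> int DIM('a) simplex K"
  using triangulation by (auto simp: triangulation_of_def)

lemma convex_K: "K \<in> T \<Longrightarrow> convex K" and compact_K: "K \<in> T \<Longrightarrow> compact K"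
  using simplex_K convex_simplex compact_simplex by blast+

lemma K_eq_hull: "K \<in> T \<Longrightarrow> K = convex hull {v. v extreme_point_of K}"
  by (rule Krein_Milman_Minkowski[OF compact_K convex_K])

text \<open>The constant gradient of a basis function on an element. \<open>offset\<close> is chosen
  after \<open>slope\<close>, so that both belong to the same affine representation.\<close>

definition slope :: "'a set \<Rightarrow> nat \<Rightarrow> 'a" where
  "slope K i = (SOME g. \<exists>c. \<forall>x\<in>K. \<phi> i x = g \<bullet> x + c)"

definition offset :: "'a set \<Rightarrow> nat \<Rightarrow> real" where
  "offset K i = (SOME c. \<forall>x\<in>K. \<phi> i x = slope K i \<bullet> x + c)"

lemma \<phi>_affine:
  assumes "K \<in> T" "i < N" "x \<in> K"
  shows "\<phi> i x = slope K i \<bullet> x + offset K i"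
proof -
  have "\<exists>g c. \<forall>x\<in>K. \<phi> i x = g \<bullet> x + c"
    using fe[OF assms(2)] assms(1) by (auto simp: fe_space_def)
  then have "\<exists>c. \<forall>x\<in>K. \<phi> i x = slope K i \<bullet> x + c"
    unfolding slope_def by (rule someI_ex)
  then have "\<forall>x\<in>K. \<phi> i x = slope K i \<bullet> x + offset K i"
    unfolding offset_def by (rule someI_ex)
  then show ?thesis using assms(3) by blast
qed

lemma \<phi>_outside: "i < N \<Longrightarrow> x \<notin> \<Omega> \<Longrightarrow> \<phi> i x = 0"
  using fe by (auto simp: fe_space_def)

lemma continuous_\<phi>: "i < N \<Longrightarrow> continuous_on (closure \<Omega>) (\<phi> i)"
  using fe by (auto simp: fe_space_def)

lemma z_in_\<Omega>: "j < N \<Longrightarrow> z j \<in> \<Omega>"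
  using nodes by (auto simp: bij_betw_def interior_nodes_def)

text \<open>A vertex inside \<open>\<Omega>\<close> is one of the nodes, and outside
  \<open>\<Omega>\<close> finite element functions vanish. All vertex values of basis functions are
  thereby known.\<close>

lemma vertex_cases:
  assumes "K \<in> T" "v extreme_point_of K"
  obtains j where "j < N" "v = z j" | "\<And>i. i < N \<Longrightarrow> \<phi> i v = 0"
proof (cases "v \<in> \<Omega>")
  case True
  then have "v \<in> z ` {..<N}"
    using nodes assms by (auto simp: bij_betw_def interior_nodes_def)
  then show ?thesis using that(1) by auto
next
  case False
  then show ?thesis using that(2) \<phi>_outside by blast
qed

lemma \<phi>_nonneg:
  assumes "K \<in> T" "i < N" "x \<in> K"
  shows "0 \<le> \<phi> i x"
  unfolding \<phi>_affine[OF assms]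
proof (rule affine_nonneg_on_hull)
  show "x \<in> convex hull {v. v extreme_point_of K}"
    using K_eq_hull[OF assms(1)] assms(3) by simp
  fix v assume v: "v \<in> {v. v extreme_point_of K}"
  then have vK: "v \<in> K" by (simp add: extreme_point_of_def)
  show "0 \<le> slope K i \<bullet> v + offset K i"
    unfolding \<phi>_affine[OF assms(1,2) vK, symmetric]
    using v assms(2) by (auto intro: vertex_cases[OF assms(1), of v] simp: delta)
qed

text \<open>At a vertex the sum is 1 for an interior node and 0 on the boundary, which carries no
  basis function; hence an inequality rather than a partition of unity.\<close>

lemma sum_\<phi>_le_1:
  assumes "K \<in> T" "x \<in> K"
  shows "(\<Sum>i<N. \<phi> i x) \<le> 1"
proof -
  have eq: "(- (\<Sum>i<N. slope K i)) \<bullet> y + (1 - (\<Sum>i<N. offset K i)) = 1 - (\<Sum>i<N. \<phi> i y)" if "y \<in> K" for y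
    using \<phi>_affine[OF assms(1) _ that] by (simp add: inner_sum_left sum.distrib)
  have "0 \<le> (- (\<Sum>i<N. slope K i)) \<bullet> x + (1 - (\<Sum>i<N. offset K i))"
  proof (rule affine_nonneg_on_hull)
    show "x \<in> convex hull {v. v extreme_point_of K}"
      using K_eq_hull[OF assms(1)] assms(2) by simp
    fix v assume v: "v \<in> {v. v extreme_point_of K}"
    then have vK: "v \<in> K" by (simp add: extreme_point_of_def)
    have "(\<Sum>i<N. \<phi> i v) \<le> 1"
    proof (rule vertex_cases[OF assms(1), of v])
      fix j assume "j < N" "v = z j"
      then show ?thesis by (simp add: delta)
    qed (use v in auto)
    then show "0 \<le> (- (\<Sum>i<N. slope K i)) \<bullet> v + (1 - (\<Sum>i<N. offset K i))"
      unfolding eq[OF vK] by simp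
  qed
  then show ?thesis
    unfolding eq[OF assms(2)] by simp
qed

text \<open>If the node lies outside the element, the basis function vanishes at all its vertices,
  hence is nonpositive on it, and nonnegativity makes it zero there.\<close>

lemma node_in_support_element:
  assumes "K \<in> T" "i < N" "x \<in> K" "\<phi> i x \<noteq> 0"
  shows "z i \<in> K"
proof (rule ccontr)
  assume "z i \<notin> K"
  have vert: "\<phi> i v = 0" if v: "v extreme_point_of K" for v
  proof (rule vertex_cases[OF assms(1) v])
    fix j assume j: "j < N" "v = z j"
    with v have "z j \<in> K" by (simp add: extreme_point_of_def)
    with \<open>z i \<notin> K\<close> have "i \<noteq> j" by auto
    then show ?thesis using j assms(2) by (simp add: delta)
  qed (use assms(2) in auto)
  have "0 \<le> (- slope K i) \<bullet> x + (- offset K i)"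
  proof (rule affine_nonneg_on_hull)
    show "x \<in> convex hull {v. v extreme_point_of K}"
      using K_eq_hull[OF assms(1)] assms(3) by simp
    fix v assume v: "v \<in> {v. v extreme_point_of K}"
    then have "v \<in> K" by (simp add: extreme_point_of_def)
    from \<phi>_affine[OF assms(1,2) this] vert[of v] v
    show "0 \<le> (- slope K i) \<bullet> v + (- offset K i)" by simp
  qed
  then have "\<phi> i x \<le> 0"
    using \<phi>_affine[OF assms(1,2,3)] by simp
  then show False
    using \<phi>_nonneg[OF assms(1,2,3)] assms(4) by simp
qed

lemma \<phi>_bounds:
  assumes "i < N" "x \<in> closure \<Omega>"
  shows "0 \<le> \<phi> i x" "\<phi> i x \<le> 1"
proof -
  obtain K where K: "K \<in> T" "x \<in> K"
    using assms(2) Union_T by blast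
  show "0 \<le> \<phi> i x"
    using \<phi>_nonneg K assms(1) by blast
  have "\<phi> i x \<le> (\<Sum>i<N. \<phi> i x)"
    using assms(1) \<phi>_nonneg[OF K(1) _ K(2)] by (intro member_le_sum) auto
  then show "\<phi> i x \<le> 1"
    using sum_\<phi>_le_1[OF K] by simp
qed

lemma gradient_\<phi>:
  assumes "K \<in> T" "i < N" "x \<in> interior K"
  shows "gradient (\<phi> i) x = slope K i"
  using \<phi>_affine[OF assms(1,2)] interior_subset
  by (intro gradient_affine_on_open[OF open_interior assms(3)]) blast

text \<open>The gradient of the function with nodal values \<open>\<xi>\<close>, almost everywhere.
  Combining the basis gradients keeps it linear in \<open>\<xi>\<close> even on element boundaries,
  where \<open>gradient\<close> may be an arbitrary value.\<close>

definition grad :: "(nat \<Rightarrow> real) \<Rightarrow> 'a \<Rightarrow> 'a" where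
  "grad \<xi> x = (\<Sum>i<N. \<xi> i *\<^sub>R gradient (\<phi> i) x)"

lemma grad_interior:
  assumes "K \<in> T" "x \<in> interior K"
  shows "grad \<xi> x = (\<Sum>i<N. \<xi> i *\<^sub>R slope K i)"
  unfolding grad_def using gradient_\<phi>[OF assms(1) _ assms(2)] by (intro sum.cong) auto

lemma diameter_le_meshsize: "K \<in> T \<Longrightarrow> diameter K \<le> meshsize T"
  using finite_T by (simp add: meshsize_def)

text \<open>Two nodes whose basis functions overlap at a point lie in a common element, on which the
  interpolated function is affine.\<close>
lemma mass_density_le:
  assumes K: "K \<in> T" "x \<in> interior K"
  shows "(\<Sum>i<N. \<Sum>j<N. \<phi> i x * \<phi> j x * (\<xi> i - \<xi> j)\<^sup>2) \<le> (meshsize T)\<^sup>2 * (norm (grad \<xi> x))\<^sup>2"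
proof -
  have xK: "x \<in> K" using K(2) interior_subset by blast
  define g where "g = grad \<xi> x"
  define R where "R = (meshsize T)\<^sup>2 * (norm g)\<^sup>2"
  have osc: "(\<xi> i - \<xi> j)\<^sup>2 \<le> R" if ij: "i < N" "j < N" "\<phi> i x \<noteq> 0" "\<phi> j x \<noteq> 0" for i j
  proof -
    have zK: "z i \<in> K" "z j \<in> K"
      using node_in_support_element K(1) xK ij by blast+
    have u: "(\<Sum>k<N. \<xi> k * \<phi> k (z l)) = \<xi> l" if "l < N" for l
    proof -
      have "(\<Sum>k<N. \<xi> k * \<phi> k (z l)) = (\<Sum>k<N. if k = l then \<xi> k else 0)"
        using that by (intro sum.cong) (auto simp: delta)
      then show ?thesis using that by simp
    qed
    have "\<xi> i - \<xi> j = (\<Sum>k<N. \<xi> k * (\<phi> k (z i) - \<phi> k (z j)))"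
      by (simp add: right_diff_distrib sum_subtractf u ij)
    also have "\<dots> = (\<Sum>k<N. \<xi> k * (slope K k \<bullet> (z i - z j)))"
      using zK K(1) by (intro sum.cong refl) (simp add: \<phi>_affine[OF K(1)] inner_diff_right)
    also have "\<dots> = g \<bullet> (z i - z j)"
      by (simp add: g_def grad_interior[OF K] inner_sum_left)
    finally have "\<bar>\<xi> i - \<xi> j\<bar> \<le> norm g * norm (z i - z j)"
      using Cauchy_Schwarz_ineq2 by simp
    also have "\<dots> \<le> norm g * meshsize T"
      using diameter_bounded_bound[OF compact_imp_bounded[OF compact_K[OF K(1)]] zK] diameter_le_meshsize[OF K(1)]
      by (intro mult_left_mono) (auto simp: dist_norm)
    finally have "\<bar>\<xi> i - \<xi> j\<bar>\<^sup>2 \<le> (norm g * meshsize T)\<^sup>2"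
      by (intro power_mono) auto
    then show ?thesis by (simp add: R_def power_mult_distrib mult.commute)
  qed
  have nn: "0 \<le> \<phi> i x" if "i < N" for i
    using \<phi>_nonneg[OF K(1) that xK] .
  have "(\<Sum>i<N. \<Sum>j<N. \<phi> i x * \<phi> j x * (\<xi> i - \<xi> j)\<^sup>2) \<le> (\<Sum>i<N. \<Sum>j<N. \<phi> i x * \<phi> j x * R)"
  proof (intro sum_mono)
    fix i j assume ij: "i \<in> {..<N}" "j \<in> {..<N}"
    show "\<phi> i x * \<phi> j x * (\<xi> i - \<xi> j)\<^sup>2 \<le> \<phi> i x * \<phi> j x * R"
    proof (cases "\<phi> i x = 0 \<or> \<phi> j x = 0")
      case False
      then show ?thesis using osc[of i j] nn ij by (intro mult_left_mono) auto
    qed auto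
  qed
  \<comment> \<open>\<open>R\<close> is the same for all pairs, so the weights factor into the
    square of a sum that is at most 1.\<close>
  also have "\<dots> = (\<Sum>i<N. \<phi> i x)\<^sup>2 * R"
    unfolding power2_eq_square sum_product by (simp add: sum_distrib_right)
  also have "\<dots> \<le> 1 * R"
    using sum_\<phi>_le_1[OF K(1) xK] nn
    by (intro mult_right_mono power_le_one sum_nonneg) (auto simp: R_def)
  finally show ?thesis by (simp add: R_def g_def)
qed

section \<open>Element boundaries as a null set, measurability and integrability\<close>

definition skeleton :: "'a set" where
  "skeleton = (\<Union>K\<in>T. frontier K)"

lemma negligible_skeleton: "negligible skeleton"
  unfolding skeleton_def
  using finite_T convex_K by (intro negligible_Union) (auto intro: negligible_convex_frontier)

lemma interior_or_skeleton:
  assumes "x \<in> \<Omega>"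
  shows "x \<in> skeleton \<or> (\<exists>K\<in>T. x \<in> interior K)"
proof -
  obtain K where "K \<in> T" "x \<in> K"
    using assms closure_subset Union_T by blast
  moreover have "K \<subseteq> interior K \<union> frontier K"
    using closure_subset by (auto simp: frontier_def)
  ultimately show ?thesis by (auto simp: skeleton_def)
qed

lemma \<Omega>_sets: "\<Omega> \<in> sets lebesgue" and \<Omega>_lmeasurable: "\<Omega> \<in> lmeasurable"
  using open_\<Omega> bounded_\<Omega> by (auto intro: lmeasurable_open)

text \<open>Allows estimates that hold only inside elements to be integrated over
  \<open>\<Omega>\<close>.\<close>

lemma AE_interior: "AE x in lebesgue_on \<Omega>. \<exists>K\<in>T. x \<in> interior K"
proof -
  have "AE x in lebesgue. x \<notin> skeleton"
    using negligible_skeleton by (auto simp: negligible_iff_null_sets intro: AE_not_in)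
  then have "AE x in lebesgue. x \<in> \<Omega> \<longrightarrow> (\<exists>K\<in>T. x \<in> interior K)"
    by eventually_elim (use interior_or_skeleton in blast)
  then show ?thesis
    using \<Omega>_sets by (subst AE_restrict_space_iff) auto
qed

lemma AE_in_\<Omega>: "AE x in lebesgue_on \<Omega>. x \<in> \<Omega>"
  by (rule AE_I2) (simp add: space_restrict_space)

lemma integrable_bounded:
  fixes f :: "'a \<Rightarrow> real"
  assumes "f \<in> borel_measurable (lebesgue_on \<Omega>)" "AE x in lebesgue_on \<Omega>. norm (f x) \<le> B"
  shows "integrable (lebesgue_on \<Omega>) f"
proof (rule Bochner_Integration.integrable_bound[OF _ assms(1)])
  show "integrable (lebesgue_on \<Omega>) (\<lambda>x. B)"
    using finite_measure_lebesgue_on[OF \<Omega>_lmeasurable] by (rule finite_measure.integrable_const)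
  show "AE x in lebesgue_on \<Omega>. norm (f x) \<le> norm B"
    using assms(2) by eventually_elim simp
qed

lemma \<phi>_measurable: "i < N \<Longrightarrow> \<phi> i \<in> borel_measurable (lebesgue_on \<Omega>)"
  by (rule continuous_imp_measurable_on_sets_lebesgue[OF continuous_on_subset[OF continuous_\<phi> closure_subset] \<Omega>_sets])

lemma integrable_mass:
  assumes "i < N" "j < N"
  shows "integrable (lebesgue_on \<Omega>) (\<lambda>x. \<phi> i x * \<phi> j x)"
proof (rule integrable_bounded)
  show "(\<lambda>x. \<phi> i x * \<phi> j x) \<in> borel_measurable (lebesgue_on \<Omega>)"
    using assms \<phi>_measurable by (intro borel_measurable_times)
  show "AE x in lebesgue_on \<Omega>. norm (\<phi> i x * \<phi> j x) \<le> 1"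
    using AE_in_\<Omega>
  proof eventually_elim
    case (elim x)
    then have "x \<in> closure \<Omega>" using closure_subset by blast
    then show ?case
      using \<phi>_bounds[OF assms(1), of x] \<phi>_bounds[OF assms(2), of x] by (simp add: abs_mult mult_le_one)
  qed
qed

text \<open>The element interiors and the skeleton cover \<open>\<Omega>\<close>. The gradient is
  constant on each interior; on the skeleton its values are irrelevant, since every subset of a null
  set is Lebesgue measurable.\<close>

lemma gradient_\<phi>_measurable:
  assumes i: "i < N"
  shows "gradient (\<phi> i) \<in> borel_measurable (lebesgue_on \<Omega>)"
proof (rule measurable_piecewise_restrict)
  let ?C = "insert skeleton (interior ` T)"
  show "countable ?C"
    using finite_T by (auto intro: countable_finite)
  show "space (lebesgue_on \<Omega>) \<subseteq> \<Union>?C"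
    using interior_or_skeleton by (auto simp: space_restrict_space)
  have sets: "S \<in> sets lebesgue" if "S \<in> ?C" for S
    using that negligible_skeleton by (auto intro: negligible_imp_sets)
  then show "S \<inter> space (lebesgue_on \<Omega>) \<in> sets (lebesgue_on \<Omega>)" if "S \<in> ?C" for S
    using that \<Omega>_sets by (auto simp: sets_restrict_space_iff space_restrict_space)
  fix S assume S: "S \<in> ?C"
  show "gradient (\<phi> i) \<in> borel_measurable (restrict_space (lebesgue_on \<Omega>) S)"
  proof (cases "S = skeleton")
    case True
    show ?thesis
    proof (rule measurableI)
      fix B :: "'a set"
      let ?P = "gradient (\<phi> i) -` B \<inter> space (restrict_space (lebesgue_on \<Omega>) S)"
      have sub: "?P \<subseteq> skeleton \<inter> \<Omega>"
        by (auto simp: space_restrict_space True)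
      then have "?P \<in> sets lebesgue"
        using negligible_subset[OF negligible_skeleton, of ?P] by (auto intro: negligible_imp_sets)
      then have "?P \<in> sets (lebesgue_on \<Omega>)"
        using sub \<Omega>_sets by (auto simp: sets_restrict_space_iff)
      then show "?P \<in> sets (restrict_space (lebesgue_on \<Omega>) S)"
        unfolding sets_restrict_space[of "lebesgue_on \<Omega>" S]
        using sub True by (intro image_eqI[of _ _ ?P]) auto
    qed auto
  next
    case False
    then obtain K where K: "K \<in> T" "S = interior K" using S by auto
    show ?thesis
    proof (rule measurable_cong[THEN iffD2])
      show "gradient (\<phi> i) x = slope K i" if "x \<in> space (restrict_space (lebesgue_on \<Omega>) S)" for x
        using that gradient_\<phi>[OF K(1) i] by (auto simp: space_restrict_space K(2))
    qed simp
  qed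
qed

text \<open>A crude bound, the sum over all elements dominating each single slope; it only serves
  integrability.\<close>

lemma AE_norm_gradient_\<phi>_le:
  assumes "i < N"
  shows "AE x in lebesgue_on \<Omega>. norm (gradient (\<phi> i) x) \<le> (\<Sum>K\<in>T. norm (slope K i))"
  using AE_interior
proof eventually_elim
  case (elim x)
  then obtain K where K: "K \<in> T" "x \<in> interior K" by blast
  then show ?case
    using member_le_sum[of K T "\<lambda>K. norm (slope K i)"] finite_T
    by (simp add: gradient_\<phi>[OF K(1) assms K(2)])
qed

text \<open>A finite element function with vanishing gradient takes finitely many values, so it is
  constant on the connected set \<open>closure \<Omega>\<close>, hence equal to its boundary value \<open>0\<close>.\<close>
lemma grad_zero_imp_zero:
  assumes AE0: "AE x in lebesgue_on \<Omega>. grad \<xi> x = 0" and l: "l < N"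
  shows "\<xi> l = 0"
proof -
  \<comment> \<open>A nonzero slope would make the open set
    \<open>interior K \<inter> \<Omega>\<close> null, hence empty, although \<open>K\<close> has
    nonempty interior inside \<open>closure \<Omega>\<close>.\<close>
  have slope0: "(\<Sum>i<N. \<xi> i *\<^sub>R slope K i) = 0" if K: "K \<in> T" for K
  proof (rule ccontr)
    assume ne: "(\<Sum>i<N. \<xi> i *\<^sub>R slope K i) \<noteq> 0"
    have "AE x in lebesgue. x \<in> \<Omega> \<longrightarrow> grad \<xi> x = 0"
      using AE0 \<Omega>_sets by (subst (asm) AE_restrict_space_iff) auto
    then have "AE x in lebesgue. x \<notin> interior K \<inter> \<Omega>"
      by eventually_elim (use grad_interior[OF K] ne in auto)
    moreover have "interior K \<inter> \<Omega> \<in> sets lebesgue"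
      using \<Omega>_sets by (intro sets.Int) auto
    ultimately have "negligible (interior K \<inter> \<Omega>)"
      using AE_iff_null_sets[of "interior K \<inter> \<Omega>" lebesgue] by (simp add: negligible_iff_null_sets)
    then have "interior K \<inter> \<Omega> = {}"
      using open_not_negligible[of "interior K \<inter> \<Omega>"] open_Int[OF open_interior open_\<Omega>] by auto
    then have "interior K \<inter> closure \<Omega> = {}"
      by (simp add: open_Int_closure_eq_empty)
    moreover have "interior K \<subseteq> closure \<Omega>"
      using K Union_T interior_subset by blast
    ultimately show False
      using simplex_interior_nonempty[OF simplex_K[OF K]] by blast
  qed
  define u where "u x = (\<Sum>i<N. \<xi> i * \<phi> i x)" for x
  have u_K: "u x = (\<Sum>i<N. \<xi> i * offset K i)" if "K \<in> T" "x \<in> K" for K x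
  proof -
    have "u x = (\<Sum>i<N. \<xi> i *\<^sub>R slope K i) \<bullet> x + (\<Sum>i<N. \<xi> i * offset K i)"
      unfolding u_def inner_sum_left sum.distrib[symmetric]
      by (intro sum.cong refl) (simp add: \<phi>_affine[OF that(1) _ that(2)] algebra_simps)
    then show ?thesis using slope0[OF that(1)] by simp
  qed
  have "u ` closure \<Omega> \<subseteq> (\<lambda>K. \<Sum>i<N. \<xi> i * offset K i) ` T"
    using u_K Union_T by blast
  then have "finite (u ` closure \<Omega>)"
    using finite_T finite_surj by blast
  moreover have "continuous_on (closure \<Omega>) u"
    unfolding u_def using continuous_\<phi> by (intro continuous_intros) auto
  ultimately have "u constant_on closure \<Omega>"
    using connected_imp_connected_closure[OF connected_\<Omega>] by (intro continuous_finite_range_constant)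
  then obtain c where c: "\<And>x. x \<in> closure \<Omega> \<Longrightarrow> u x = c"
    by (auto simp: constant_on_def)
  \<comment> \<open>A bounded nonempty set has a boundary point; as \<open>\<Omega>\<close> is open,
    that point lies outside it, where \<open>u\<close> is zero.\<close>
  have "frontier \<Omega> \<noteq> {}"
    using nonempty_\<Omega> bounded_\<Omega> not_bounded_UNIV by (intro frontier_not_empty) auto
  then obtain w where "w \<in> closure \<Omega>" "w \<notin> \<Omega>"
    using open_\<Omega> by (auto simp: frontier_def interior_open)
  moreover from this have "u w = 0"
    by (simp add: u_def \<phi>_outside)
  ultimately have "c = 0" using c by simp
  have "u (z l) = (\<Sum>i<N. if i = l then \<xi> i else 0)"
    unfolding u_def using l by (intro sum.cong) (auto simp: delta)
  then have "u (z l) = \<xi> l" using l by simp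
  then show ?thesis
    using c[of "z l"] z_in_\<Omega>[OF l] closure_subset \<open>c = 0\<close> by auto
qed

end

section \<open>The lumping error as a quadratic form\<close>

context fe_mesh
begin

lemma symmetric_mass: "symmetric N (mass_matrix \<Omega> N \<phi>)"
  by (simp add: symmetric_def mass_matrix_def mult.commute)

lemma mass_matrix_carrier: "mass_matrix \<Omega> N \<phi> \<in> carrier_mat N N"
  by (simp add: mass_matrix_def)

text \<open>Moves the graph Laplacian under the integral, where \<open>mass_density_le\<close>
  applies pointwise.\<close>

lemma qform_lumping_error:
  "qform N (lumped (mass_matrix \<Omega> N \<phi>) - mass_matrix \<Omega> N \<phi>) \<xi>
     = (LINT x|lebesgue_on \<Omega>. (\<Sum>i<N. \<Sum>j<N. \<phi> i x * \<phi> j x * (\<xi> i - \<xi> j)\<^sup>2)) / 2"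
proof -
  have "(LINT x|lebesgue_on \<Omega>. (\<Sum>i<N. \<Sum>j<N. \<phi> i x * \<phi> j x * (\<xi> i - \<xi> j)\<^sup>2))
      = (\<Sum>i<N. LINT x|lebesgue_on \<Omega>. (\<Sum>j<N. \<phi> i x * \<phi> j x * (\<xi> i - \<xi> j)\<^sup>2))"
    by (intro Bochner_Integration.integral_sum Bochner_Integration.integrable_sum integrable_mult_left integrable_mass) auto
  also have "\<dots> = (\<Sum>i<N. \<Sum>j<N. LINT x|lebesgue_on \<Omega>. \<phi> i x * \<phi> j x * (\<xi> i - \<xi> j)\<^sup>2)"
    by (intro sum.cong refl Bochner_Integration.integral_sum integrable_mult_left integrable_mass) auto
  also have "\<dots> = (\<Sum>i<N. \<Sum>j<N. mass_matrix \<Omega> N \<phi> $$ (i, j) * (\<xi> i - \<xi> j)\<^sup>2)"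
    by (intro sum.cong refl) (simp add: mass_matrix_def)
  finally show ?thesis
    by (simp add: qform_lumped_diff[OF mass_matrix_carrier symmetric_mass])
qed

lemma integrable_mass_density:
  "integrable (lebesgue_on \<Omega>) (\<lambda>x. \<Sum>i<N. \<Sum>j<N. \<phi> i x * \<phi> j x * (\<xi> i - \<xi> j)\<^sup>2)"
  by (intro Bochner_Integration.integrable_sum integrable_mult_left integrable_mass) auto

lemma qform_lumping_error_nonneg:
  "0 \<le> qform N (lumped (mass_matrix \<Omega> N \<phi>) - mass_matrix \<Omega> N \<phi>) \<xi>"
proof -
  have "AE x in lebesgue_on \<Omega>. 0 \<le> (\<Sum>i<N. \<Sum>j<N. \<phi> i x * \<phi> j x * (\<xi> i - \<xi> j)\<^sup>2)"
    using AE_in_\<Omega>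
  proof eventually_elim
    case (elim x)
    then have "x \<in> closure \<Omega>" using closure_subset by blast
    then show ?case
      using \<phi>_bounds(1) by (intro sum_nonneg mult_nonneg_nonneg) auto
  qed
  then show ?thesis
    unfolding qform_lumping_error by (intro divide_nonneg_nonneg integral_nonneg_AE) auto
qed

end

section \<open>Stiffness forms and their comparison with the lumping error\<close>

text \<open>The bounds are parameters, so that both coefficients can be used with a common
  \<open>\<alpha>\<close>.\<close>

locale fe_diffusion = fe_mesh \<Omega> T N \<phi> z
  for \<Omega> :: "(real^'d) set" and T N \<phi> z +
  fixes a :: "real^'d \<Rightarrow> real^'d^'d" and \<alpha> \<beta> :: real
  assumes diffusion: "diffusion_coefficient \<Omega> a"
    and \<alpha>_pos: "0 < \<alpha>"
    and lower: "x \<in> \<Omega> \<Longrightarrow> \<alpha> * (norm \<xi>)\<^sup>2 \<le> \<xi> \<bullet> (a x *v \<xi>)"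
    and upper: "x \<in> \<Omega> \<Longrightarrow> \<xi> \<bullet> (a x *v \<xi>) \<le> \<beta> * (norm \<xi>)\<^sup>2"
begin

lemma sym_a: "x \<in> \<Omega> \<Longrightarrow> transpose (a x) = a x"
  using diffusion by (simp add: diffusion_coefficient_def)

lemma a_nonneg: "x \<in> \<Omega> \<Longrightarrow> 0 \<le> \<xi> \<bullet> (a x *v \<xi>)"
  using lower[of x \<xi>] \<alpha>_pos by (smt (verit) mult_nonneg_nonneg zero_le_power2)

lemma \<beta>_nonneg: "0 \<le> \<beta>"
proof -
  obtain x where x: "x \<in> \<Omega>" using nonempty_\<Omega> by blast
  obtain e :: "real^'d" where "norm e = 1"
    using vector_choose_size[of 1] by auto
  then show ?thesis
    using a_nonneg[OF x, of e] upper[OF x, of e] by simp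
qed

text \<open>The integrand is measurable because the matrix-vector product is jointly continuous, and
  it is essentially bounded because the basis gradients are.\<close>

lemma integrable_stiffness:
  assumes i: "i < N" and j: "j < N"
  shows "integrable (lebesgue_on \<Omega>) (\<lambda>x. (a x *v gradient (\<phi> i) x) \<bullet> gradient (\<phi> j) x)"
proof (rule integrable_bounded)
  have a: "a \<in> borel_measurable (lebesgue_on \<Omega>)"
    using diffusion by (simp add: diffusion_coefficient_def)
  have "(\<lambda>x. a x *v gradient (\<phi> i) x) \<in> borel_measurable (lebesgue_on \<Omega>)"
    using a gradient_\<phi>_measurable[OF i]
    by (rule borel_measurable_continuous_Pair) (auto simp: matrix_vector_mult_def intro!: continuous_intros)
  then show "(\<lambda>x. (a x *v gradient (\<phi> i) x) \<bullet> gradient (\<phi> j) x) \<in> borel_measurable (lebesgue_on \<Omega>)"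
    using gradient_\<phi>_measurable[OF j] by (rule borel_measurable_inner)
  let ?B = "\<lambda>i. (\<Sum>K\<in>T. norm (slope K i))"
  show "AE x in lebesgue_on \<Omega>. norm ((a x *v gradient (\<phi> i) x) \<bullet> gradient (\<phi> j) x)
          \<le> \<beta> * ((?B i)\<^sup>2 + (?B j)\<^sup>2) / 2"
    using AE_in_\<Omega> AE_norm_gradient_\<phi>_le[OF i] AE_norm_gradient_\<phi>_le[OF j]
  proof eventually_elim
    case (elim x)
    have "norm ((a x *v gradient (\<phi> i) x) \<bullet> gradient (\<phi> j) x)
        \<le> \<beta> * ((norm (gradient (\<phi> i) x))\<^sup>2 + (norm (gradient (\<phi> j) x))\<^sup>2) / 2"
      using coercive_inner_bound[OF sym_a a_nonneg upper, OF elim(1) elim(1) elim(1)] by simp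
    also have "\<dots> \<le> \<beta> * ((?B i)\<^sup>2 + (?B j)\<^sup>2) / 2"
      using elim \<beta>_nonneg by (intro divide_right_mono mult_left_mono add_mono power_mono) auto
    finally show ?case .
  qed
qed

lemma stiffness_carrier: "stiffness_matrix \<Omega> a N \<phi> \<in> carrier_mat N N"
  by (simp add: stiffness_matrix_def)

lemma symmetric_stiffness: "symmetric N (stiffness_matrix \<Omega> a N \<phi>)"
proof -
  have "(LINT x|lebesgue_on \<Omega>. (a x *v gradient (\<phi> i) x) \<bullet> gradient (\<phi> j) x)
      = (LINT x|lebesgue_on \<Omega>. (a x *v gradient (\<phi> j) x) \<bullet> gradient (\<phi> i) x)" for i j
  proof (rule Bochner_Integration.integral_cong[OF refl])
    fix x assume "x \<in> space (lebesgue_on \<Omega>)"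
    then have "x \<in> \<Omega>" by (simp add: space_restrict_space)
    from symmetric_matrix_inner[OF sym_a[OF this]]
    show "(a x *v gradient (\<phi> i) x) \<bullet> gradient (\<phi> j) x = (a x *v gradient (\<phi> j) x) \<bullet> gradient (\<phi> i) x"
      by (simp add: inner_commute)
  qed
  then show ?thesis
    by (simp add: symmetric_def stiffness_matrix_def)
qed

lemma energy_density_expand:
  "(a x *v grad \<xi> x) \<bullet> grad \<xi> x
     = (\<Sum>i<N. \<Sum>j<N. \<xi> i * ((a x *v gradient (\<phi> i) x) \<bullet> gradient (\<phi> j) x) * \<xi> j)"
  unfolding grad_def linear_sum[OF matrix_vector_mul_linear] inner_sum_left
  by (intro sum.cong refl) (simp add: matrix_vector_mult_scaleR inner_sum_right sum_distrib_left mult_ac)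

lemma integrable_energy_density: "integrable (lebesgue_on \<Omega>) (\<lambda>x. (a x *v grad \<xi> x) \<bullet> grad \<xi> x)"
  unfolding energy_density_expand
  by (intro Bochner_Integration.integrable_sum integrable_mult_left integrable_mult_right integrable_stiffness) auto

lemma qform_stiffness:
  "qform N (stiffness_matrix \<Omega> a N \<phi>) \<xi> = (LINT x|lebesgue_on \<Omega>. (a x *v grad \<xi> x) \<bullet> grad \<xi> x)"
proof -
  have "(LINT x|lebesgue_on \<Omega>. (a x *v grad \<xi> x) \<bullet> grad \<xi> x)
     = (\<Sum>i<N. LINT x|lebesgue_on \<Omega>. (\<Sum>j<N. \<xi> i * ((a x *v gradient (\<phi> i) x) \<bullet> gradient (\<phi> j) x) * \<xi> j))"
    unfolding energy_density_expand
    by (intro Bochner_Integration.integral_sum Bochner_Integration.integrable_sum integrable_mult_left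
        integrable_mult_right integrable_stiffness) auto
  also have "\<dots> = (\<Sum>i<N. \<Sum>j<N. LINT x|lebesgue_on \<Omega>. \<xi> i * ((a x *v gradient (\<phi> i) x) \<bullet> gradient (\<phi> j) x) * \<xi> j)"
    by (intro sum.cong refl Bochner_Integration.integral_sum integrable_mult_left
        integrable_mult_right integrable_stiffness) auto
  also have "\<dots> = qform N (stiffness_matrix \<Omega> a N \<phi>) \<xi>"
    unfolding qform_def by (intro sum.cong refl) (simp add: stiffness_matrix_def)
  finally show ?thesis by simp
qed

lemma energy_density_ge: "AE x in lebesgue_on \<Omega>. \<alpha> * (norm (grad \<xi> x))\<^sup>2 \<le> (a x *v grad \<xi> x) \<bullet> grad \<xi> x"
  using AE_in_\<Omega> by eventually_elim (simp add: lower inner_commute[of "a _ *v _"])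

text \<open>Zero energy forces a zero gradient almost everywhere by coercivity, and then all nodal
  values vanish by \<open>grad_zero_imp_zero\<close>.\<close>

lemma stiffness_pos_def:
  assumes "\<exists>i<N. \<xi> i \<noteq> 0"
  shows "0 < qform N (stiffness_matrix \<Omega> a N \<phi>) \<xi>"
proof -
  have nonneg: "AE x in lebesgue_on \<Omega>. 0 \<le> (a x *v grad \<xi> x) \<bullet> grad \<xi> x"
    using AE_in_\<Omega> by eventually_elim (simp add: a_nonneg inner_commute[of "a _ *v _"])
  have "qform N (stiffness_matrix \<Omega> a N \<phi>) \<xi> \<noteq> 0"
  proof
    assume "qform N (stiffness_matrix \<Omega> a N \<phi>) \<xi> = 0"
    then have "AE x in lebesgue_on \<Omega>. (a x *v grad \<xi> x) \<bullet> grad \<xi> x = 0"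
      unfolding qform_stiffness using integral_nonneg_eq_0_iff_AE[OF integrable_energy_density nonneg] by simp
    then have "AE x in lebesgue_on \<Omega>. grad \<xi> x = 0"
      using energy_density_ge[of \<xi>]
      by eventually_elim (use \<alpha>_pos in \<open>simp add: mult_le_0_iff\<close>)
    then show False
      using grad_zero_imp_zero assms by blast
  qed
  moreover have "0 \<le> qform N (stiffness_matrix \<Omega> a N \<phi>) \<xi>"
    unfolding qform_stiffness using nonneg by (rule integral_nonneg_AE)
  ultimately show ?thesis by simp
qed

text \<open>Integrates the pointwise oscillation bound and trades the squared gradient for energy at
  the price of \<open>1 / \<alpha>\<close>. The remaining factor one half comes from the symmetrized
  form of the error.\<close>

lemma lumping_error_le_stiffness:
  "qform N (lumped (mass_matrix \<Omega> N \<phi>) - mass_matrix \<Omega> N \<phi>) \<xi>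
     \<le> (meshsize T)\<^sup>2 / (2 * \<alpha>) * qform N (stiffness_matrix \<Omega> a N \<phi>) \<xi>"
proof -
  have "(LINT x|lebesgue_on \<Omega>. (\<Sum>i<N. \<Sum>j<N. \<phi> i x * \<phi> j x * (\<xi> i - \<xi> j)\<^sup>2))
      \<le> (LINT x|lebesgue_on \<Omega>. (meshsize T)\<^sup>2 / \<alpha> * ((a x *v grad \<xi> x) \<bullet> grad \<xi> x))"
  proof (rule integral_mono_AE[OF integrable_mass_density integrable_mult_right[OF integrable_energy_density]])
    show "AE x in lebesgue_on \<Omega>. (\<Sum>i<N. \<Sum>j<N. \<phi> i x * \<phi> j x * (\<xi> i - \<xi> j)\<^sup>2)
        \<le> (meshsize T)\<^sup>2 / \<alpha> * ((a x *v grad \<xi> x) \<bullet> grad \<xi> x)"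
      using AE_interior energy_density_ge[of \<xi>]
    proof eventually_elim
      case (elim x)
      then have "(\<Sum>i<N. \<Sum>j<N. \<phi> i x * \<phi> j x * (\<xi> i - \<xi> j)\<^sup>2) \<le> (meshsize T)\<^sup>2 * (norm (grad \<xi> x))\<^sup>2"
        using mass_density_le by blast
      also have "\<dots> = (meshsize T)\<^sup>2 / \<alpha> * (\<alpha> * (norm (grad \<xi> x))\<^sup>2)"
        using \<alpha>_pos by simp
      also have "\<dots> \<le> (meshsize T)\<^sup>2 / \<alpha> * ((a x *v grad \<xi> x) \<bullet> grad \<xi> x)"
        using elim(2) \<alpha>_pos by (intro mult_left_mono) auto
      finally show ?case .
    qed
  qed
  then show ?thesis
    unfolding qform_lumping_error qform_stiffness by simp
qed

end

section \<open>Choice of the constant and assembly\<close>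

theorem theorem1:
  fixes \<Omega> :: "(real^'d) set"
    and a b :: "real^'d \<Rightarrow> real^'d^'d"
    and \<sigma> :: real
  assumes "polyhedral_domain \<Omega>"
    and "diffusion_coefficient \<Omega> a"
    and "diffusion_coefficient \<Omega> b"
  shows "\<exists>C>0. \<forall>T N \<phi> \<tau>.
    triangulation_of \<Omega> T \<and> shape_regular \<sigma> T \<and>
    nodal_basis \<Omega> T N \<phi> \<and> N > 0 \<and>
    \<tau> > 0 \<and> \<tau> \<ge> C * (meshsize T)\<^sup>2 \<longrightarrow>
    (let M = mass_matrix \<Omega> N \<phi>;
         A = stiffness_matrix \<Omega> a N \<phi>;
         B = stiffness_matrix \<Omega> b N \<phi>;
         \<A> = system_matrix \<tau> A M B;
         \<B> = system_matrix \<tau> A (lumped M) B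
     in \<exists>\<B>inv. mat_inverse \<B> = Some \<B>inv \<and>
          spectral_radius (map_mat complex_of_real (\<B>inv * \<A>)) < 2)"
proof -
  obtain \<alpha>\<^sub>a \<beta>\<^sub>a where a: "0 < \<alpha>\<^sub>a"
    "\<forall>x\<in>\<Omega>. \<forall>\<xi>. \<alpha>\<^sub>a * (norm \<xi>)\<^sup>2 \<le> \<xi> \<bullet> (a x *v \<xi>) \<and>
      \<xi> \<bullet> (a x *v \<xi>) \<le> \<beta>\<^sub>a * (norm \<xi>)\<^sup>2"
    using diffusion_coefficient_bounds[OF assms(2)] by blast
  obtain \<alpha>\<^sub>b \<beta>\<^sub>b where b: "0 < \<alpha>\<^sub>b"
    "\<forall>x\<in>\<Omega>. \<forall>\<xi>. \<alpha>\<^sub>b * (norm \<xi>)\<^sup>2 \<le> \<xi> \<bullet> (b x *v \<xi>) \<and>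
      \<xi> \<bullet> (b x *v \<xi>) \<le> \<beta>\<^sub>b * (norm \<xi>)\<^sup>2"
    using diffusion_coefficient_bounds[OF assms(3)] by blast
  \<comment> \<open>The smaller coercivity constant serves both coefficients, so one constant
    \<open>c\<close> compares the lumping error with either stiffness form.\<close>
  define \<alpha> where "\<alpha> = min \<alpha>\<^sub>a \<alpha>\<^sub>b"
  have \<alpha>: "0 < \<alpha>" "\<alpha> \<le> \<alpha>\<^sub>a" "\<alpha> \<le> \<alpha>\<^sub>b"
    using a(1) b(1) by (auto simp: \<alpha>_def)
  have main: "\<exists>\<B>inv. mat_inverse (system_matrix \<tau> (stiffness_matrix \<Omega> a N \<phi>) (lumped (mass_matrix \<Omega> N \<phi>))
        (stiffness_matrix \<Omega> b N \<phi>)) = Some \<B>inv \<and>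
      spectral_radius (map_mat complex_of_real (\<B>inv * system_matrix \<tau> (stiffness_matrix \<Omega> a N \<phi>)
        (mass_matrix \<Omega> N \<phi>) (stiffness_matrix \<Omega> b N \<phi>))) < 2"
    if T: "triangulation_of \<Omega> T" and nb: "nodal_basis \<Omega> T N \<phi>" and N: "N > 0"
      and \<tau>: "\<tau> > 0" "\<tau> \<ge> 1 / \<alpha> * (meshsize T)\<^sup>2" for T N \<phi> \<tau>
  proof -
    obtain z where z: "bij_betw z {..<N} (interior_nodes \<Omega> T)"
      "\<And>i. i < N \<Longrightarrow> \<phi> i \<in> fe_space \<Omega> T"
      "\<And>i j. i < N \<Longrightarrow> j < N \<Longrightarrow> \<phi> i (z j) = (if i = j then 1 else 0)"
      using nb unfolding nodal_basis_def by blast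
    interpret fe_mesh \<Omega> T N \<phi> z
      using assms(1) T z by unfold_locales
    have lower: "\<alpha> * (norm \<xi>)\<^sup>2 \<le> \<xi> \<bullet> (a x *v \<xi>)" "\<alpha> * (norm \<xi>)\<^sup>2 \<le> \<xi> \<bullet> (b x *v \<xi>)" if "x \<in> \<Omega>" for x \<xi>
      using bspec[OF a(2) that] bspec[OF b(2) that] \<alpha>
        mult_right_mono[of \<alpha> \<alpha>\<^sub>a "(norm \<xi>)\<^sup>2"] mult_right_mono[of \<alpha> \<alpha>\<^sub>b "(norm \<xi>)\<^sup>2"]
      by (meson order_trans zero_le_power2)+
    interpret A: fe_diffusion \<Omega> T N \<phi> z a \<alpha> \<beta>\<^sub>a
      using assms(2) \<alpha>(1) lower(1) a(2) by unfold_locales auto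
    interpret B: fe_diffusion \<Omega> T N \<phi> z b \<alpha> \<beta>\<^sub>b
      using assms(3) \<alpha>(1) lower(2) b(2) by unfold_locales auto
    let ?M = "mass_matrix \<Omega> N \<phi>"
    have carL: "lumped ?M \<in> carrier_mat N N"
      by (simp add: lumped_def mass_matrix_def)
    have symL: "symmetric N (lumped ?M)" "symmetric N (lumped ?M - ?M)"
      using symmetric_mass by (auto simp: symmetric_def lumped_def mat_diag_def mass_matrix_def)
    \<comment> \<open>The constant \<open>1 / \<alpha>\<close> is twice what the comparison yields,
      which turns the weak hypothesis on \<open>\<tau>\<close> into a strict inequality. For
      meshsize 0 strictness comes from \<open>\<tau> > 0\<close>.\<close>
    have "(meshsize T)\<^sup>2 / (2 * \<alpha>) < \<tau>"
    proof (cases "meshsize T = 0")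
      case False
      then have "(meshsize T)\<^sup>2 / (2 * \<alpha>) < 1 / \<alpha> * (meshsize T)\<^sup>2"
        using \<alpha>(1) by (simp add: field_simps)
      then show ?thesis using \<tau>(2) by linarith
    qed (use \<tau> in simp)
    then show ?thesis
      by (intro spectral_radius_lumped_lt_2[where N = N and c = "(meshsize T)\<^sup>2 / (2 * \<alpha>)"]
          A.stiffness_carrier mass_matrix_carrier carL B.stiffness_carrier N
          A.symmetric_stiffness B.symmetric_stiffness symL A.stiffness_pos_def B.stiffness_pos_def
          qform_lumping_error_nonneg A.lumping_error_le_stiffness B.lumping_error_le_stiffness \<tau>(1))
  qed
  show ?thesis
    \<comment> \<open>The witness \<open>1 / \<alpha>\<close> is determined by \<open>a\<close> and
      \<open>b\<close> before any mesh, basis or \<open>\<tau>\<close> is chosen.\<close>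
    unfolding Let_def using main \<alpha>(1) by (intro exI[of _ "1 / \<alpha>"]) auto
qed

end
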